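(* Let $n$ and $m$ be positive integers, and let $\omega$ be any orientation string for $G_{n,m,2}$. Then $\omega$ constructs a Hamiltonian cycle if and only if the $\omega$-link is a knot.
   Context: The graph $G_{n,m,2}$ (an augmented directed grid graph on a two-holed torus): its vertices are the $4nm$ cells $(i,c)$ of a grid with $2n$ rows $0\le i<2n$ (row $0$ on top) and $2m$ columns $0\le c<2m$ (column $0$ leftmost). The bijection $u$ ("up") on cells is $u(i,c)=(i-1,c)$ if $i\ge 1$, and $u(0,c)=(2n-1,(c+m)\bmod 2m)$. The bijection $r$ ("right") on cells is $r(i,c)=(i,c+1)$ if $c<2m-1$, and $r(i,2m-1)=((i+n)\bmod 2n,0)$. The directed edges are $(\alpha,u\alpha)$ and $(\alpha,r\alpha)$ for every cell $\alpha$. A diagonal is an orbit of the permutation $u^{-1}r$ (apply $r$ first, then $u^{-1}$) on cells. An orientation string $\omega$ assigns to each diagonal a letter $U$ or $R$; every cell of the diagonal is then oriented up, respectively right. We say $\omega$ constructs a Hamiltonian cycle if the subgraph in which each cell $\alpha$ keeps only the out-edge to $u\alpha$ (if oriented up) or to $r\alpha$ (if oriented right) is a single directed cycle through all $4nm$ cells. Boundaries: $A$ consists of the cells $(0,c)$ with $0\le c<m$; $B$ of the cells $(0,c)$ with $m\le c<2m$; $C$ of the cells $(i,2m-1)$ with $0\le i<n$; $D$ of the cells $(i,2m-1)$ with $n\le i<2n$. The $\omega$-link is the link with parameters $(a,b,c,d)$, where $a$ and $b$ are the numbers of cells of $A$ and $B$ oriented up, and $c$ and $d$ are the numbers of cells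 of $C$ and $D$ oriented right. The link with parameters $(a,b,c,d)$ (non-negative integers) is a union of loops on the two-holed torus crossing the four boundaries $A,B,C,D$ respectively $a,b,c,d$ times. Combinatorially, its segments are numbered $0,\dots,a+b+c+d-1$, and the segment following each segment is given by the permutation that maps the following half-open integer intervals onto each other in increasing order (by translation): $[0,a)\to[b+c+d,a+b+c+d)$, $[a,a+b)\to[c+d,b+c+d)$, $[a+b,a+b+c)\to[d,c+d)$, $[a+b+c,a+b+c+d)\to[0,d)$. The loops of the link are the cycles of this permutation, and the link is a knot if it has exactly one loop. *)

theory Defs
  imports "Graph_Theory.Arc_Walk" "HOL-Combinatorics.Orbits"
begin

text \<open>
  A cell is a pair (row, column); row 0 is the top row. The maps \<open>up\<close> and \<open>right\<close> below are
  meaningful on \<open>cells n m\<close> only.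
\<close>

type_synonym cell = "nat \<times> nat"

definition cells :: "nat \<Rightarrow> nat \<Rightarrow> cell set" where
  "cells n m = {0..<2 * n} \<times> {0..<2 * m}"

fun up :: "nat \<Rightarrow> nat \<Rightarrow> cell \<Rightarrow> cell" where
  "up n m (i, c) = (if i \<ge> 1 then (i - 1, c) else (2 * n - 1, (c + m) mod (2 * m)))"

fun right :: "nat \<Rightarrow> nat \<Rightarrow> cell \<Rightarrow> cell" where
  "right n m (i, c) = (if c < 2 * m - 1 then (i, c + 1) else ((i + n) mod (2 * n), 0))"

lemma bij_betw_up: "bij_betw (up n m) (cells n m) (cells n m)"
proof -
  have "inj_on (up n m) (cells n m)"
    by (auto simp: inj_on_def cells_def mod_if split: if_splits)
  moreover have "up n m ` cells n m \<subseteq> cells n m"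
    by (auto simp: cells_def split: if_splits)
  ultimately show ?thesis
    by (simp add: bij_betw_def endo_inj_surj cells_def)
qed

lemma bij_betw_right: "bij_betw (right n m) (cells n m) (cells n m)"
proof -
  have "inj_on (right n m) (cells n m)"
    by (auto simp: inj_on_def cells_def mod_if split: if_splits)
  moreover have "right n m ` cells n m \<subseteq> cells n m"
    by (auto simp: cells_def split: if_splits)
  ultimately show ?thesis
    by (simp add: bij_betw_def endo_inj_surj cells_def)
qed

datatype letter = U | R

text \<open>
  The graph is a multigraph: an arc is a pair of its tail and a letter. This keeps the two
  out-arcs of a cell apart even when \<open>up n m \<alpha> = right n m \<alpha>\<close>, which happens for \<open>n = m = 1\<close>.
\<close>

definition step :: "nat \<Rightarrow> nat \<Rightarrow> cell \<times> letter \<Rightarrow> cell" where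
  "step n m e = (case e of (\<alpha>, U) \<Rightarrow> up n m \<alpha> | (\<alpha>, R) \<Rightarrow> right n m \<alpha>)"

definition grid_graph :: "nat \<Rightarrow> nat \<Rightarrow> (cell, cell \<times> letter) pre_digraph" where
  "grid_graph n m =
     \<lparr>verts = cells n m, arcs = cells n m \<times> UNIV, tail = fst, head = step n m\<rparr>"

text \<open>
  \<open>orbit f x\<close> is the set of all \<open>(f ^^ k) x\<close> with \<open>k \<ge> 1\<close>; for a permutation of a finite set
  it contains \<open>x\<close> itself.
\<close>

definition diagonal :: "nat \<Rightarrow> nat \<Rightarrow> cell \<Rightarrow> cell set" where
  "diagonal n m \<alpha> = orbit (inv_into (cells n m) (up n m) \<circ> right n m) \<alpha>"

text \<open>
  The values of an orientation string on sets of cells that are not diagonals play no role.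
\<close>

type_synonym orientation_string = "cell set \<Rightarrow> letter"

definition orientation :: "nat \<Rightarrow> nat \<Rightarrow> orientation_string \<Rightarrow> cell \<Rightarrow> letter" where
  "orientation n m \<omega> \<alpha> = \<omega> (diagonal n m \<alpha>)"

definition oriented_subgraph ::
    "nat \<Rightarrow> nat \<Rightarrow> orientation_string \<Rightarrow> (cell, cell \<times> letter) pre_digraph" where
  "oriented_subgraph n m \<omega> =
     (grid_graph n m)\<lparr>arcs := (\<lambda>\<alpha>. (\<alpha>, orientation n m \<omega> \<alpha>)) ` cells n m\<rparr>"

text \<open>
  A digraph is a single directed cycle if some cycle uses all of its arcs and
  passes through all of its vertices.
\<close>

definition is_directed_cycle :: "('a, 'b) pre_digraph \<Rightarrow> bool" where
  "is_directed_cycle H \<longleftrightarrow>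
     (\<exists>p. pre_digraph.cycle H p \<and> set p = arcs H \<and> tail H ` set p = verts H)"

definition constructs_hamiltonian_cycle :: "nat \<Rightarrow> nat \<Rightarrow> orientation_string \<Rightarrow> bool" where
  "constructs_hamiltonian_cycle n m \<omega> \<longleftrightarrow> is_directed_cycle (oriented_subgraph n m \<omega>)"

definition boundary_A :: "nat \<Rightarrow> nat \<Rightarrow> cell set" where
  "boundary_A n m = {0} \<times> {0..<m}"

definition boundary_B :: "nat \<Rightarrow> nat \<Rightarrow> cell set" where
  "boundary_B n m = {0} \<times> {m..<2 * m}"

definition boundary_C :: "nat \<Rightarrow> nat \<Rightarrow> cell set" where
  "boundary_C n m = {0..<n} \<times> {2 * m - 1}"

definition boundary_D :: "nat \<Rightarrow> nat \<Rightarrow> cell set" where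
  "boundary_D n m = {n..<2 * n} \<times> {2 * m - 1}"

text \<open>
  A link is given by its parameters \<open>(a, b, c, d)\<close>; its segments are the natural numbers below
  \<open>a + b + c + d\<close>.
\<close>

type_synonym link = "nat \<times> nat \<times> nat \<times> nat"

fun segments :: "link \<Rightarrow> nat set" where
  "segments (a, b, c, d) = {0..<a + b + c + d}"

fun next_segment :: "link \<Rightarrow> nat \<Rightarrow> nat" where
  "next_segment (a, b, c, d) x =
     (if x < a then x + (b + c + d)
      else if x < a + b then (x - a) + (c + d)
      else if x < a + b + c then (x - (a + b)) + d
      else if x < a + b + c + d then x - (a + b + c)
      else x)"

definition loops :: "link \<Rightarrow> nat set set" where
  "loops L = orbit (next_segment L) ` segments L"

definition is_knot :: "link \<Rightarrow> bool" where
  "is_knot L \<longleftrightarrow> card (loops L) = 1"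

definition orientation_link :: "nat \<Rightarrow> nat \<Rightarrow> orientation_string \<Rightarrow> link" where
  "orientation_link n m \<omega> =
     (card {\<alpha> \<in> boundary_A n m. orientation n m \<omega> \<alpha> = U},
      card {\<alpha> \<in> boundary_B n m. orientation n m \<omega> \<alpha> = U},
      card {\<alpha> \<in> boundary_C n m. orientation n m \<omega> \<alpha> = R},
      card {\<alpha> \<in> boundary_D n m. orientation n m \<omega> \<alpha> = R})"

end

theory Submission
  imports Defs
begin

text \<open>
  Cut along the grid boundary, the oriented subgraph becomes a family of strands that enter at the
  left or bottom side and leave at the top or right side. Number the entries down the left side and
  then along the bottom, and the exits along the top and then down the right side. Since
  orientations are constant on diagonals, each level \<open>c - i = s\<close> moves as a block, so the strands
  keep their order: the \<open>k\<close>-th entry is joined to the \<open>k\<close>-th exit. An explicit formula \<open>strand\<close> for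
  the number of the strand through a cell makes this precise. Gluing the sides back together acts
  on strand numbers as \<open>next_segment\<close>, which is therefore the first-return map of the oriented
  subgraph to its exit cells, and one map is a single cycle iff the other is.
\<close>

section \<open>Cycles of maps and first returns\<close>

text \<open>\<open>orbit\<close> begins with the first iterate, so this says that \<open>x\<close>
  is periodic. Extending \<open>f\<close> by the identity outside \<open>S\<close> gives a
  permutation of the whole type with the same orbit of \<open>x\<close>.\<close>

lemma in_own_orbit:
  assumes "bij_betw f S S" "finite S" "x \<in> S"
  shows "x \<in> orbit f x"
proof -
  let ?g = "perm_restrict f S"
  have "bij_betw ?g S S"
    using assms(1) by (subst bij_betw_cong[of S ?g f]) (auto simp: perm_restrict_def)
  then have "?g permutes S"
    by (intro bij_imp_permutes) (auto simp: perm_restrict_def)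
  then have "permutation ?g"
    using assms(2) by (auto simp: permutation_permutes)
  then have "x \<in> orbit ?g x"
    by (rule permutation_self_in_orbit)
  moreover have "orbit f x = orbit ?g x"
    using assms by (intro orbit_cong0[of x S]) (auto simp: perm_restrict_def bij_betw_def)
  ultimately show ?thesis by simp
qed

text \<open>The label \<open>\<phi>\<close> is constant along \<open>f\<close> until
  \<open>E\<close> is left and then changes by \<open>g\<close>; the measure \<open>\<mu>\<close>
  forces every path into \<open>E\<close>. As \<open>\<phi>\<close> is injective on
  \<open>E\<close>, \<open>g\<close> is the first-return map of \<open>f\<close> to
  \<open>E\<close>, read on labels.\<close>

lemma cyclic_on_first_return:
  fixes f :: "'a \<Rightarrow> 'a" and g :: "'b \<Rightarrow> 'b" and \<phi> :: "'a \<Rightarrow> 'b" and \<mu> :: "'a \<Rightarrow> nat"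
  assumes f: "bij_betw f S S" and fin: "finite S" and E: "E \<subseteq> S" "E \<noteq> {}"
    and \<phi>: "bij_betw \<phi> E T"
    and stay: "\<And>x. x \<in> S \<Longrightarrow> x \<notin> E \<Longrightarrow> \<phi> (f x) = \<phi> x"
    and exit: "\<And>x. x \<in> E \<Longrightarrow> \<phi> (f x) = g (\<phi> x)"
    and descent: "\<And>x. x \<in> S \<Longrightarrow> x \<notin> E \<Longrightarrow> \<mu> (f x) < \<mu> x"
  shows "cyclic_on f S \<longleftrightarrow> cyclic_on g T"
proof -
  have fS: "f x \<in> S" if "x \<in> S" for x
    using f that by (auto simp: bij_betw_def)
  \<comment> \<open>Descent on \<open>\<mu>\<close> up to the next exit; \<open>insert x\<close>
    adds the zeroth iterate, which \<open>orbit\<close> leaves out.\<close>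
  have reach: "\<exists>z\<in>E. \<phi> z = \<phi> x \<and> z \<in> insert x (orbit f x)" if "x \<in> S" for x
    using that
  proof (induction "\<mu> x" arbitrary: x rule: less_induct)
    case less
    show ?case
    proof (cases "x \<in> E")
      case False
      then obtain z where "z \<in> E" "\<phi> z = \<phi> (f x)" "z \<in> insert (f x) (orbit f (f x))"
        using less.hyps[OF descent fS] less.prems by blast
      then show ?thesis
        using stay[OF less.prems False] by (auto intro: orbit.base orbit_subset)
    qed auto
  qed
  have orbit_S: "y \<in> S" if "y \<in> orbit f x" "x \<in> S" for x y
    using that by induction (auto intro: fS)
  have push: "\<phi> y \<in> orbit g (\<phi> x)" if "y \<in> orbit f x" "x \<in> E" for x y
    using that
  proof induction
    case base
    then show ?case by (simp add: exit orbit.base)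
  next
    case (step y)
    moreover have "y \<in> S" using step orbit_S E by blast
    ultimately show ?case
      by (cases "y \<in> E") (simp_all add: exit stay orbit.step)
  qed
  have lift: "\<exists>z\<in>E. z \<in> orbit f x \<and> \<phi> z = t" if "t \<in> orbit g (\<phi> x)" "x \<in> E" for t x
    using that
  proof induction
    case base
    then obtain z where "z \<in> E" "\<phi> z = \<phi> (f x)" "z \<in> insert (f x) (orbit f (f x))"
      using reach fS E by blast
    then show ?case
      using base exit by (auto intro: orbit.base orbit_subset)
  next
    case (step t)
    then obtain y where y: "y \<in> E" "y \<in> orbit f x" "\<phi> y = t" by blast
    then obtain z where "z \<in> E" "\<phi> z = \<phi> (f y)" "z \<in> insert (f y) (orbit f (f y))"
      using reach fS E by blast
    then show ?case
      using y exit by (metis insert_iff orbit.step orbit_subset orbit_trans)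
  qed
  show ?thesis
  proof
    assume cyc: "cyclic_on f S"
    from E obtain x where x: "x \<in> E" by blast
    then have S: "S = orbit f x"
      using cyc E by (auto simp: cyclic_on_alldef)
    have "T \<subseteq> orbit g (\<phi> x)"
      using \<phi> E push x unfolding S by (auto simp: bij_betw_def)
    moreover have "orbit g (\<phi> x) \<subseteq> T"
      using lift x \<phi> by (auto simp: bij_betw_def)
    moreover have "\<phi> x \<in> T"
      using x \<phi> by (auto simp: bij_betw_def)
    ultimately show "cyclic_on g T"
      by (auto simp: cyclic_on_def)
  next
    assume cyc: "cyclic_on g T"
    have "y \<in> orbit f x" if x: "x \<in> S" and y: "y \<in> S" for x y
    \<comment> \<open>Go from \<open>x\<close> to its exit \<open>x'\<close>, follow
      \<open>g\<close> to the exit \<open>y'\<close> of \<open>y\<close>, and finally get back from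
      \<open>y'\<close> to \<open>y\<close>.\<close>
    proof -
      obtain x' where x': "x' \<in> E" "\<phi> x' = \<phi> x" "x' \<in> insert x (orbit f x)"
        using reach x by blast
      obtain y' where y': "y' \<in> E" "\<phi> y' = \<phi> y" "y' \<in> insert y (orbit f y)"
        using reach y by blast
      have "\<phi> x' \<in> T" "\<phi> y' \<in> T"
        using x'(1) y'(1) bij_betwE[OF \<phi>] by blast+
      then have "\<phi> y' \<in> orbit g (\<phi> x')"
        using orbit_cyclic_eq3[OF cyc] by simp
      then obtain z where z: "z \<in> E" "z \<in> orbit f x'" "\<phi> z = \<phi> y'"
        using lift[OF _ x'(1)] by blast
      then have "z = y'"
        using y'(1) bij_betw_imp_inj_on[OF \<phi>] by (simp add: inj_on_eq_iff)
      then have "y' \<in> orbit f x"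
        using z(2) x'(3) by (metis insertE orbit_trans)
      \<comment> \<open>Here \<open>y'\<close> lies ahead of \<open>y\<close>; since
        \<open>f\<close> permutes a finite set, its orbits are symmetric and the path can be closed
        up.\<close>
      moreover have "y' \<in> orbit f y"
        using y'(3) in_own_orbit[OF f fin y] by auto
      then have "y \<in> orbit f y'"
        by (rule orbit_swap[OF in_own_orbit[OF f fin y]])
      ultimately show ?thesis
        by (metis orbit_trans)
    qed
    then have "S = orbit f x" if "x \<in> S" for x
      using that orbit_S by blast
    then show "cyclic_on f S"
      using E by (auto simp: cyclic_on_def)
  qed
qed

section \<open>Directed cycles in graphs with one out-arc per vertex\<close>

lemma map_tail_cas:
  assumes "pre_digraph.cas H u p v" "\<And>e. e \<in> set p \<Longrightarrow> head H e = f (tail H e)"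
  shows "map (tail H) p = map (\<lambda>k. (f ^^ k) u) [0..<length p] \<and> (f ^^ length p) u = v"
  using assms
proof (induction p arbitrary: u)
  case Nil
  then show ?case by (simp add: pre_digraph.cas.simps)
next
  case (Cons e p)
  then have "tail H e = u" "pre_digraph.cas H (f u) p v"
    by (auto simp: pre_digraph.cas.simps)
  with Cons show ?case
    by (simp add: map_upt_Suc funpow_swap1 del: upt_Suc)
qed

lemma cas_funpow:
  assumes "\<And>k. tail H (a ((f ^^ k) u)) = (f ^^ k) u" "\<And>k. head H (a ((f ^^ k) u)) = (f ^^ Suc k) u"
  shows "pre_digraph.cas H u (map (\<lambda>k. a ((f ^^ k) u)) [0..<l]) ((f ^^ l) u)"
  using assms
proof (induction l arbitrary: u)
  case 0
  then show ?case by (simp add: pre_digraph.cas.simps)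
next
  case (Suc l)
  have "pre_digraph.cas H (f u) (map (\<lambda>k. a ((f ^^ k) (f u))) [0..<l]) ((f ^^ l) (f u))"
    using Suc.prems[of "Suc _"] by (intro Suc.IH) (simp_all add: funpow_swap1)
  then show ?case
    using Suc.prems[of 0]
    by (simp add: map_upt_Suc funpow_swap1 pre_digraph.cas.simps del: upt_Suc)
qed

text \<open>The only arc leaving \<open>v\<close> is \<open>a v\<close>, so a walk is determined by
  its start and its length, and its vertices are the iterates of \<open>f\<close>.\<close>

lemma is_directed_cycle_iff_cyclic_on:
  assumes arcs: "arcs H = a ` verts H"
    and tail: "\<And>v. v \<in> verts H \<Longrightarrow> tail H (a v) = v"
    and head: "\<And>v. v \<in> verts H \<Longrightarrow> head H (a v) = f v"
  shows "is_directed_cycle H \<longleftrightarrow> cyclic_on f (verts H)"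
proof
  assume "is_directed_cycle H"
  then obtain p u where p: "pre_digraph.awalk H u p u" "p \<noteq> []"
    "set p = arcs H" "tail H ` set p = verts H"
    by (auto simp: is_directed_cycle_def pre_digraph.cycle_def)
  then have "head H e = f (tail H e)" if "e \<in> set p" for e
    using that arcs tail head by auto
  then have *: "map (tail H) p = map (\<lambda>k. (f ^^ k) u) [0..<length p]" "(f ^^ length p) u = u"
    using p map_tail_cas[of H u p u f] by (auto simp: pre_digraph.awalk_def)
  have "verts H = set (map (tail H) p)"
    using p by simp
  also have "\<dots> = {(f ^^ k) u | k. k < length p}"
    unfolding *(1) by auto
  also have "\<dots> = orbit f u"
    using p * orbit_altdef_bounded[of "length p" f u] by simp
  finally have "verts H = orbit f u" .
  moreover have "u \<in> verts H"
    using p by (auto simp: pre_digraph.awalk_def)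
  ultimately show "cyclic_on f (verts H)"
    by (auto simp: cyclic_on_def)
next
  assume "cyclic_on f (verts H)"
  then obtain u where u: "u \<in> verts H" "verts H = orbit f u"
    by (auto simp: cyclic_on_def)
  \<comment> \<open>The least positive period of \<open>u\<close>.\<close>
  define l where "l = funpow_dist1 f u u"
  define p where "p = map (\<lambda>k. a ((f ^^ k) u)) [0..<l]"
  have l: "l > 0" "(f ^^ l) u = u"
    using funpow_dist1_prop[of u f u] u unfolding l_def by blast+
  have verts: "verts H = (\<lambda>k. (f ^^ k) u) ` {0..<l}"
    using orbit_conv_funpow_dist1[of u f] u by (simp add: l_def)
  have in_verts: "(f ^^ k) u \<in> verts H" for k
    using funpow_in_orbit[of u f u] u by simp
  have set_p: "set p = arcs H"
    by (auto simp: p_def arcs verts)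
  have cas: "pre_digraph.cas H u p u"
    using cas_funpow[of H a f u l] in_verts tail head unfolding p_def l(2) by simp
  \<comment> \<open>A cycle needs distinct heads, which are the iterates 1 to \<open>l\<close>. The
    last of them is \<open>u\<close> itself, so it is separated from the others by the minimality of
    \<open>l\<close>.\<close>
  have ne: "(f ^^ Suc i) u \<noteq> (f ^^ Suc j) u" if "i < j" "j < l" for i j
  proof (cases "Suc j = l")
    case True
    then show ?thesis
      using that l funpow_dist1_least[of "Suc i" f u u] by (simp add: l_def)
  next
    case False
    then show ?thesis
      using that u funpow_neq_less_funpow_dist1[of u f u "Suc i" "Suc j"] by (simp add: l_def)
  qed
  have "inj_on (\<lambda>k. (f ^^ Suc k) u) {0..<l}"
    by (rule linorder_inj_onI) (use ne in \<open>simp_all add: linear del: funpow.simps\<close>)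
  moreover have "map (head H) p = map (\<lambda>k. (f ^^ Suc k) u) [0..<l]"
    using in_verts head by (simp add: p_def)
  ultimately have "distinct (map (head H) p)"
    by (simp add: distinct_map del: funpow.simps)
  moreover have "tl (pre_digraph.awalk_verts H u p) = map (head H) p"
    using pre_digraph.awalk_verts_conv'[OF cas] by simp
  moreover have "p \<noteq> []"
    using l by (simp add: p_def)
  ultimately have "pre_digraph.cycle H p"
    unfolding pre_digraph.cycle_def pre_digraph.awalk_def
    using cas u(1) set_p by (intro exI[of _ u]) simp
  moreover have "tail H ` set p = verts H"
    using tail by (simp add: arcs set_p image_image)
  ultimately show "is_directed_cycle H"
    using set_p unfolding is_directed_cycle_def by blast
qed

section \<open>Knots as cyclic permutations of the segments\<close>

lemma bij_betw_next_segment: "bij_betw (next_segment L) (segments L) (segments L)"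
proof -
  obtain a b c d where L: "L = (a, b, c, d)" by (cases L)
  have "inj_on (next_segment L) (segments L)"
    unfolding L by (rule inj_onI) (auto split: if_splits)
  moreover have "next_segment L ` segments L \<subseteq> segments L"
    by (auto simp: L split: if_splits)
  moreover have "finite (segments L)" by (simp add: L)
  ultimately show ?thesis
    by (simp add: bij_betw_def endo_inj_surj)
qed

text \<open>An orbit shared by all segments is the whole segment set: each segment lies in its own
  orbit, and no orbit leaves the set.\<close>

lemma is_knot_iff_cyclic_on: "is_knot L \<longleftrightarrow> cyclic_on (next_segment L) (segments L)"
proof
  assume "is_knot L"
  then obtain T where loops: "orbit (next_segment L) ` segments L = {T}"
    by (auto simp: is_knot_def loops_def card_1_singleton_iff)
  have fin: "finite (segments L)" by (cases L) simp
  have orb: "orbit (next_segment L) x = T" if "x \<in> segments L" for x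
    using loops that by blast
  have "x \<in> T" if "x \<in> segments L" for x
    using in_own_orbit[OF bij_betw_next_segment fin that] orb that by simp
  moreover have "y \<in> segments L" if "y \<in> orbit (next_segment L) x" "x \<in> segments L" for x y
    using that by induction (use bij_betwE[OF bij_betw_next_segment] in blast)+
  moreover have "segments L \<noteq> {}" using loops by auto
  ultimately show "cyclic_on (next_segment L) (segments L)"
    unfolding cyclic_on_def using orb by blast
next
  assume "cyclic_on (next_segment L) (segments L)"
  then have "loops L = {segments L}"
    unfolding loops_def cyclic_on_alldef by blast
  then show "is_knot L" by (simp add: is_knot_def)
qed

section \<open>Counting below a bound\<close>

text \<open>For \<open>k\<close> satisfying \<open>P\<close> this is the rank of \<open>k\<close>,
  counted from 0, among the numbers satisfying \<open>P\<close>.\<close>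

definition count_below :: "(nat \<Rightarrow> bool) \<Rightarrow> nat \<Rightarrow> nat" where
  "count_below P k = card {j. j < k \<and> P j}"

lemma count_below_0 [simp]: "count_below P 0 = 0"
  by (simp add: count_below_def)

lemma count_below_Suc [simp]:
  "count_below P (Suc k) = count_below P k + (if P k then 1 else 0)"
proof -
  have "{j. j < Suc k \<and> P j} = (if P k then insert k {j. j < k \<and> P j} else {j. j < k \<and> P j})"
    by (auto simp: less_Suc_eq)
  then show ?thesis by (simp add: count_below_def)
qed

lemma count_below_mono: "j \<le> k \<Longrightarrow> count_below P j \<le> count_below P k"
  by (induction rule: dec_induct) auto

lemma count_below_less: "P j \<Longrightarrow> j < k \<Longrightarrow> count_below P j < count_below P k"
  using count_below_mono[of "Suc j" k P] by simp

text \<open>The count starts at 0 and rises by at most 1, so it takes the value \<open>x\<close> at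
  the index where it rises past \<open>x\<close>.\<close>

lemma count_below_onto: "x < count_below P k \<Longrightarrow> \<exists>j<k. P j \<and> count_below P j = x"
proof (induction k)
  case (Suc k)
  then show ?case
    by (cases "x < count_below P k") (auto split: if_splits intro: less_SucI)
qed simp

text \<open>\<open>Q\<close> is \<open>P\<close> with the two halves of \<open>[0, 2h)\<close>
  interchanged, as in the half turns by which the grid sides are glued. The equations are additive
  to avoid truncated subtraction.\<close>

lemma count_below_rotate:
  fixes P :: "nat \<Rightarrow> bool" and h :: nat
  defines "Q \<equiv> \<lambda>j. P ((j + h) mod (2 * h))"
  assumes "k \<le> h"
  shows "count_below Q k + count_below P h = count_below P (h + k)"
    and "count_below Q (h + k) + count_below P h = count_below P (2 * h) + count_below P k"
proof -
  have *: "count_below Q k + count_below P h = count_below P (h + k)" if "k \<le> h" for k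
    using that by (induction k) (auto simp: Q_def add.commute)
  then show "count_below Q k + count_below P h = count_below P (h + k)"
    using assms(2) .
  have [simp]: "(h + k + h) mod (2 * h) = k" if "k < h" for k
  proof -
    have "h + k + h = k + 2 * h" by simp
    then show ?thesis using that by (simp only: mod_add_self2) simp
  qed
  show "count_below Q (h + k) + count_below P h = count_below P (2 * h) + count_below P k"
    using assms(2)
  proof (induction k)
    case 0
    then show ?case using *[of h] by (simp add: mult_2)
  next
    case (Suc k)
    then show ?case by (simp add: Q_def)
  qed
qed

section \<open>Strands\<close>

lemma letter_neq_U: "l \<noteq> U \<longleftrightarrow> l = R"
  by (cases l) auto

locale oriented_grid =
  fixes n m :: nat and \<omega> :: orientation_string
  assumes n: "n > 0" and m: "m > 0"
begin

abbreviation letter_at :: "nat \<Rightarrow> nat \<Rightarrow> letter" where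
  "letter_at i c \<equiv> orientation n m \<omega> (i, c)"

definition flow :: "cell \<Rightarrow> cell" where
  "flow \<alpha> = step n m (\<alpha>, orientation n m \<omega> \<alpha>)"

definition exit_top :: "nat \<Rightarrow> bool" where
  "exit_top c \<longleftrightarrow> letter_at 0 c = U"

definition exit_right :: "nat \<Rightarrow> bool" where
  "exit_right i \<longleftrightarrow> letter_at i (2 * m - 1) = R"

text \<open>A half turn is its own inverse, so the column whose top cell leads up into column
  \<open>c\<close> of the bottom row is again \<open>(c + m) mod (2 * m)\<close>. Likewise for
  \<open>enter_left\<close>.\<close>

definition enter_bottom :: "nat \<Rightarrow> bool" where
  "enter_bottom c \<longleftrightarrow> exit_top ((c + m) mod (2 * m))"

definition enter_left :: "nat \<Rightarrow> bool" where
  "enter_left i \<longleftrightarrow> exit_right ((i + n) mod (2 * n))"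

text \<open>
  Both subtractions are truncated, so at most one of the two counts is non-zero. On level
  \<open>s = c - i\<close>, the strands numbered below those of the level itself are the ones that already
  left through the top (\<open>s > 0\<close>) or that enter later through the left side (\<open>s < 0\<close>);
  \<open>min i c\<close> is the position within the level.
\<close>

fun strand :: "cell \<Rightarrow> nat" where
  "strand (i, c) = count_below enter_left (i - c) + count_below exit_top (c - i) + min i c"

definition exits :: "cell set" where
  "exits = (\<lambda>c. (0, c)) ` {c. c < 2 * m \<and> exit_top c} \<union>
     (\<lambda>i. (i, 2 * m - 1)) ` {i. i < 2 * n \<and> exit_right i}"

section \<open>Diagonals and bijectivity of the flow\<close>

lemma finite_cells: "finite (cells n m)"
  by (simp add: cells_def)

text \<open>The last assumption makes \<open>\<beta>\<close> the successor of
  \<open>\<alpha>\<close> on its diagonal, and the orbit of a permutation does not depend on its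
  starting point.\<close>

lemma orientation_eqI:
  assumes "\<alpha> \<in> cells n m" "\<beta> \<in> cells n m" "up n m \<beta> = right n m \<alpha>"
  shows "orientation n m \<omega> \<alpha> = orientation n m \<omega> \<beta>"
proof -
  let ?f = "inv_into (cells n m) (up n m) \<circ> right n m"
  have "bij_betw ?f (cells n m) (cells n m)"
    using bij_betw_trans[OF bij_betw_right bij_betw_inv_into[OF bij_betw_up]] .
  then have "\<alpha> \<in> orbit ?f \<alpha>"
    using finite_cells assms(1) by (rule in_own_orbit)
  then have "orbit ?f (?f \<alpha>) = orbit ?f \<alpha>"
    by (rule self_in_orbit_step)
  moreover have "?f \<alpha> = \<beta>"
    using bij_betw_inv_into_left[OF bij_betw_up assms(2)] by (simp add: assms(3))
  ultimately show ?thesis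
    unfolding orientation_def diagonal_def by metis
qed

text \<open>Two cells with different letters can only collide if one moves right and the other up
  into the same cell; but then they share a diagonal, hence a letter.\<close>

lemma bij_betw_flow: "bij_betw flow (cells n m) (cells n m)"
proof -
  have up: "up n m \<alpha> \<in> cells n m" and right: "right n m \<alpha> \<in> cells n m" if "\<alpha> \<in> cells n m" for \<alpha>
    using bij_betwE[OF bij_betw_up] bij_betwE[OF bij_betw_right] that by blast+
  have "inj_on flow (cells n m)"
  proof (rule inj_onI)
    fix \<alpha> \<beta>
    assume *: "\<alpha> \<in> cells n m" "\<beta> \<in> cells n m" "flow \<alpha> = flow \<beta>"
    have "orientation n m \<omega> \<alpha> = orientation n m \<omega> \<beta>"
      using * orientation_eqI[of \<alpha> \<beta>] orientation_eqI[of \<beta> \<alpha>]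
      by (cases "orientation n m \<omega> \<alpha>"; cases "orientation n m \<omega> \<beta>")
        (simp_all add: flow_def step_def)
    moreover have "inj_on (up n m) (cells n m)" "inj_on (right n m) (cells n m)"
      using bij_betw_up bij_betw_right by (auto simp: bij_betw_def)
    ultimately show "\<alpha> = \<beta>"
      using * by (cases "orientation n m \<omega> \<alpha>") (simp_all add: flow_def step_def inj_on_eq_iff)
  qed
  moreover have "flow ` cells n m \<subseteq> cells n m"
    using up right by (auto simp: flow_def step_def split: letter.splits)
  ultimately show ?thesis
    by (simp add: bij_betw_def endo_inj_surj finite_cells)
qed

section \<open>Strand numbers inside the grid and along its sides\<close>

lemma letter_at_diagonal:
  "i + k < 2 * n \<Longrightarrow> c + k < 2 * m \<Longrightarrow> letter_at (i + k) (c + k) = letter_at i c"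
proof (induction k)
  case (Suc k)
  have "letter_at (i + k) (c + k) = letter_at (i + Suc k) (c + Suc k)"
    using Suc.prems by (intro orientation_eqI) (auto simp: cells_def)
  then show ?case using Suc by simp
qed simp

text \<open>The cell leading right into \<open>(j, 0)\<close> and the cell \<open>(Suc j, 0)\<close>
  below it are consecutive on a diagonal across the glued side.\<close>

lemma enter_left_iff: "j + 1 < 2 * n \<Longrightarrow> enter_left j \<longleftrightarrow> letter_at (Suc j) 0 = R"
proof -
  assume j: "j + 1 < 2 * n"
  have "((j + n) mod (2 * n) + n) mod (2 * n) = j"
    using j by (auto simp: mod_if)
  then have "letter_at ((j + n) mod (2 * n)) (2 * m - 1) = letter_at (Suc j) 0"
    using j n m by (intro orientation_eqI) (auto simp: cells_def)
  then show ?thesis by (simp add: enter_left_def exit_right_def)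
qed

text \<open>The bottom-left corner is reached by \<open>right\<close> from
  \<open>(n - 1, 2 * m - 1)\<close> and by \<open>up\<close> from \<open>(0, m)\<close>. These share
  a letter, so exactly one of them enters.\<close>

lemma enter_left_last: "enter_left (2 * n - 1) \<longleftrightarrow> \<not> enter_bottom 0"
proof -
  have *: "(2 * n - 1 + n) mod (2 * n) = n - 1"
    using n by (auto simp: mod_if)
  have "letter_at (n - 1) (2 * m - 1) = letter_at 0 m"
    using n m by (intro orientation_eqI) (auto simp: cells_def simp flip: mult_2)
  then show ?thesis
    using m unfolding enter_left_def exit_right_def * enter_bottom_def exit_top_def
    by (simp add: letter_neq_U)
qed

lemma enter_bottom_Suc_iff:
  "c + 1 < 2 * m \<Longrightarrow> enter_bottom (Suc c) \<longleftrightarrow> letter_at (2 * n - 1) c = U"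
proof -
  assume c: "c + 1 < 2 * m"
  have "((Suc c + m) mod (2 * m) + m) mod (2 * m) = Suc c"
    using c by (auto simp: mod_if)
  then have "letter_at (2 * n - 1) c = letter_at 0 ((Suc c + m) mod (2 * m))"
    using c n m by (intro orientation_eqI) (auto simp: cells_def)
  then show ?thesis by (simp add: enter_bottom_def exit_top_def)
qed

text \<open>For \<open>R\<close> the move stays on its strand; for \<open>U\<close> the right
  neighbour lies on the next strand. On or above the main diagonal a top exit is added to the count;
  below it \<open>min\<close> grows by 1, offset by a left entry exactly when the letter is
  \<open>R\<close>.\<close>

lemma strand_Suc_column:
  assumes "i < 2 * n" "Suc c < 2 * m"
  shows "strand (i, Suc c) = strand (i, c) + (if letter_at i c = U then 1 else 0)"
proof (cases "i \<le> c")
  case True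
  then have "letter_at i c = letter_at 0 (c - i)"
    using letter_at_diagonal[of 0 i "c - i"] assms by simp
  then show ?thesis using True by (simp add: Suc_diff_le exit_top_def)
next
  case False
  then obtain j where j: "i = Suc j + c"
    using less_imp_Suc_add[of c i] by auto
  then have "letter_at i c = letter_at (Suc j) 0"
    using letter_at_diagonal[of "Suc j" c 0] assms by simp
  then show ?thesis
    using assms j enter_left_iff[of j] by (simp add: letter_neq_U)
qed

lemma strand_Suc_row:
  assumes "Suc i < 2 * n" "c < 2 * m"
  shows "strand (Suc i, c) = strand (i, c) + (if letter_at (Suc i) c = R then 1 else 0)"
proof (cases "c \<le> i")
  case True
  then have "letter_at (Suc i) c = letter_at (Suc (i - c)) 0"
    using letter_at_diagonal[of "Suc (i - c)" c 0] assms by simp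
  then show ?thesis
    using assms True enter_left_iff[of "i - c"] by (simp add: Suc_diff_le)
next
  case False
  then obtain j where j: "c = Suc j + i"
    using less_imp_Suc_add[of i c] by auto
  then have "letter_at (Suc i) c = letter_at 0 j"
    using letter_at_diagonal[of 0 "Suc i" j] assms by simp
  then show ?thesis
    using j by (simp add: exit_top_def letter_neq_U)
qed

text \<open>The strand through a cell of the right column is the last one to exit along the top and
  down to that row. \<open>Suc\<close> appears because numbering starts at 0. The corner
  \<open>(0, 2 * m - 1)\<close> exits exactly once, upwards or to the right, which starts the
  induction.\<close>

lemma strand_right_column:
  "i < 2 * n \<Longrightarrow>
    Suc (strand (i, 2 * m - 1)) = count_below exit_top (2 * m) + count_below exit_right (Suc i)"
proof (induction i)
  case 0
  have "count_below exit_top (2 * m) =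
      count_below exit_top (2 * m - 1) + (if exit_top (2 * m - 1) then 1 else 0)"
    using m count_below_Suc[of exit_top "2 * m - 1"] by simp
  moreover have "exit_right 0 \<longleftrightarrow> \<not> exit_top (2 * m - 1)"
    by (simp add: exit_top_def exit_right_def letter_neq_U)
  ultimately show ?case by simp
next
  case (Suc i)
  have "strand (Suc i, 2 * m - 1) = strand (i, 2 * m - 1) + (if exit_right (Suc i) then 1 else 0)"
    using strand_Suc_row[of i "2 * m - 1"] Suc.prems m unfolding exit_right_def by linarith
  then show ?case
    using Suc count_below_Suc[of exit_right "Suc i"] by linarith
qed

lemma strand_bottom_row:
  "c < 2 * m \<Longrightarrow>
    Suc (strand (2 * n - 1, c)) = count_below enter_left (2 * n) + count_below enter_bottom (Suc c)"
proof (induction c)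
  case 0
  have "count_below enter_left (2 * n) =
      count_below enter_left (2 * n - 1) + (if enter_left (2 * n - 1) then 1 else 0)"
    using n count_below_Suc[of enter_left "2 * n - 1"] by simp
  \<comment> \<open>The corner is entered exactly once, from the left or from below.\<close>
  then show ?case
    using enter_left_last by simp
next
  case (Suc c)
  then have "strand (2 * n - 1, Suc c) =
      strand (2 * n - 1, c) + (if enter_bottom (Suc c) then 1 else 0)"
    using strand_Suc_column[of "2 * n - 1" c] enter_bottom_Suc_iff[of c] n by (simp del: strand.simps)
  then show ?case
    using Suc count_below_Suc[of enter_bottom "Suc c"] by linarith
qed

lemma strand_exit_top: "strand (0, c) = count_below exit_top c"
  by simp

lemma strand_exit_right:
  "i < 2 * n \<Longrightarrow> exit_right i \<Longrightarrow>
    strand (i, 2 * m - 1) = count_below exit_top (2 * m) + count_below exit_right i"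
  using strand_right_column[of i] by simp

lemma strand_enter_bottom:
  "c < 2 * m \<Longrightarrow> enter_bottom c \<Longrightarrow>
    strand (2 * n - 1, c) = count_below enter_left (2 * n) + count_below enter_bottom c"
  using strand_bottom_row[of c] by simp

section \<open>Gluing the sides: exits, re-entries and link segments\<close>

lemma orientation_link_eq:
  obtains a b c d where
    "orientation_link n m \<omega> = (a, b, c, d)"
    "count_below exit_top m = a" "count_below exit_top (2 * m) = a + b"
    "count_below exit_right n = c" "count_below exit_right (2 * n) = c + d"
proof -
  have split: "count_below P (2 * h) = count_below P h + card {j. h \<le> j \<and> j < 2 * h \<and> P j}" for P h
  proof -
    have "{j. j < 2 * h \<and> P j} = {j. j < h \<and> P j} \<union> {j. h \<le> j \<and> j < 2 * h \<and> P j}"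
      by auto
    moreover have "finite {j. h \<le> j \<and> j < 2 * h \<and> P j}"
      by (rule finite_subset[of _ "{..<2 * h}"]) auto
    ultimately show ?thesis
      unfolding count_below_def by (simp add: card_Un_disjoint disjoint_iff)
  qed
  have A: "{\<alpha> \<in> boundary_A n m. orientation n m \<omega> \<alpha> = U} = Pair 0 ` {j. j < m \<and> exit_top j}"
    and B: "{\<alpha> \<in> boundary_B n m. orientation n m \<omega> \<alpha> = U} =
      Pair 0 ` {j. m \<le> j \<and> j < 2 * m \<and> exit_top j}"
    by (auto simp: boundary_A_def boundary_B_def exit_top_def)
  have C: "{\<alpha> \<in> boundary_C n m. orientation n m \<omega> \<alpha> = R} =
      (\<lambda>i. (i, 2 * m - 1)) ` {j. j < n \<and> exit_right j}"
    and D: "{\<alpha> \<in> boundary_D n m. orientation n m \<omega> \<alpha> = R} =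
      (\<lambda>i. (i, 2 * m - 1)) ` {j. n \<le> j \<and> j < 2 * n \<and> exit_right j}"
    by (auto simp: boundary_C_def boundary_D_def exit_right_def)
  have "orientation_link n m \<omega> =
      (count_below exit_top m, card {j. m \<le> j \<and> j < 2 * m \<and> exit_top j},
       count_below exit_right n, card {j. n \<le> j \<and> j < 2 * n \<and> exit_right j})"
    unfolding orientation_link_def A B C D by (simp add: card_image inj_on_def count_below_def)
  then show ?thesis
    by (rule that) (simp_all add: split)
qed

text \<open>Left entries are numbered first, so re-entry at the bottom is offset by the
  \<open>c + d\<close> exits on the right; the half turn interchanges the blocks of \<open>A\<close>
  and \<open>B\<close>. This is the action of \<open>next_segment\<close> on its first two
  intervals.\<close>

lemma strand_flow_exit_top:
  assumes "c < 2 * m" "exit_top c"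
  shows "strand (flow (0, c)) = next_segment (orientation_link n m \<omega>) (strand (0, c))"
proof -
  obtain p q r s where link: "orientation_link n m \<omega> = (p, q, r, s)"
    and counts: "count_below exit_top m = p" "count_below exit_top (2 * m) = p + q"
    "count_below exit_right n = r" "count_below exit_right (2 * n) = r + s"
    by (rule orientation_link_eq)
  define c' where "c' = (c + m) mod (2 * m)"
  have c': "c' < 2 * m" "(c' + m) mod (2 * m) = c"
    using assms m by (auto simp: c'_def mod_if)
  then have "strand (2 * n - 1, c') = count_below enter_left (2 * n) + count_below enter_bottom c'"
    using assms by (intro strand_enter_bottom) (simp_all add: enter_bottom_def)
  moreover have "flow (0, c) = (2 * n - 1, c')"
    using assms by (simp add: flow_def step_def exit_top_def c'_def)
  moreover have "count_below enter_left (2 * n) = r + s"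
    using count_below_rotate(2)[of n n exit_right] counts
    by (simp add: enter_left_def[abs_def] mult_2)
  ultimately have flow: "strand (flow (0, c)) = r + s + count_below enter_bottom c'"
    by simp
  show ?thesis
  proof (cases "c < m")
    case True
    then have "c' = m + c" by (simp add: c'_def)
    then have "count_below enter_bottom c' = q + count_below exit_top c"
      using count_below_rotate(2)[of c m exit_top] counts True
      by (simp add: enter_bottom_def[abs_def])
    moreover have "count_below exit_top c < p"
      using count_below_less[of exit_top c m] assms True counts by simp
    ultimately show ?thesis
      unfolding flow link strand_exit_top by simp
  next
    case False
    then have "c' = c - m" using assms by (simp add: c'_def mod_if)
    then have "count_below enter_bottom c' + p = count_below exit_top c"
      using count_below_rotate(1)[of "c - m" m exit_top] counts False assms
      by (simp add: enter_bottom_def[abs_def])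
    moreover have "count_below exit_top c < p + q"
      using count_below_less[of exit_top c "2 * m"] assms counts by simp
    ultimately show ?thesis
      unfolding flow link strand_exit_top by auto
  qed
qed

lemma strand_flow_exit_right:
  assumes "i < 2 * n" "exit_right i"
  shows "strand (flow (i, 2 * m - 1)) =
    next_segment (orientation_link n m \<omega>) (strand (i, 2 * m - 1))"
proof -
  obtain p q r s where link: "orientation_link n m \<omega> = (p, q, r, s)"
    and counts: "count_below exit_top m = p" "count_below exit_top (2 * m) = p + q"
    "count_below exit_right n = r" "count_below exit_right (2 * n) = r + s"
    by (rule orientation_link_eq)
  define i' where "i' = (i + n) mod (2 * n)"
  have "flow (i, 2 * m - 1) = (i', 0)"
    using assms by (simp add: flow_def step_def exit_right_def i'_def)
  \<comment> \<open>In column 0 both the top count and the position within the level vanish.\<close>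
  then have flow: "strand (flow (i, 2 * m - 1)) = count_below enter_left i'"
    by simp
  have exit: "strand (i, 2 * m - 1) = p + q + count_below exit_right i"
    using strand_exit_right assms counts by simp
  show ?thesis
  proof (cases "i < n")
    case True
    then have "i' = n + i" by (simp add: i'_def)
    then have "count_below enter_left i' = s + count_below exit_right i"
      using count_below_rotate(2)[of i n exit_right] counts True
      by (simp add: enter_left_def[abs_def])
    moreover have "count_below exit_right i < r"
      using count_below_less[of exit_right i n] assms True counts by simp
    ultimately show ?thesis
      unfolding flow link exit by simp
  next
    case False
    then have "i' = i - n" using assms by (simp add: i'_def mod_if)
    then have "count_below enter_left i' + r = count_below exit_right i"
      using count_below_rotate(1)[of "i - n" n exit_right] counts False assms
      by (simp add: enter_left_def[abs_def])
    moreover have "count_below exit_right i < r + s"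
      using count_below_less[of exit_right i "2 * n"] assms counts by simp
    ultimately show ?thesis
      unfolding flow link exit by auto
  qed
qed

text \<open>On top exits \<open>strand\<close> is the rank, on right exits the rank shifted by the
  number of top exits; the two ranges are adjacent intervals.\<close>

lemma bij_betw_strand: "bij_betw strand exits (segments (orientation_link n m \<omega>))"
proof -
  obtain p q r s where link: "orientation_link n m \<omega> = (p, q, r, s)"
    and counts: "count_below exit_top m = p" "count_below exit_top (2 * m) = p + q"
    "count_below exit_right n = r" "count_below exit_right (2 * n) = r + s"
    by (rule orientation_link_eq)
  let ?top = "{c. c < 2 * m \<and> exit_top c}" and ?right = "{i. i < 2 * n \<and> exit_right i}"
  have bij: "bij_betw (count_below P) {j. j < k \<and> P j} {0..<count_below P k}" for P k
    unfolding bij_betw_def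
  proof
    show "inj_on (count_below P) {j. j < k \<and> P j}"
      by (rule linorder_inj_onI) (use count_below_less[of P] in force)+
    show "count_below P ` {j. j < k \<and> P j} = {0..<count_below P k}"
      using count_below_less[of P] count_below_onto[of _ P k] by (auto simp: image_iff) metis
  qed
  have "bij_betw strand (Pair 0 ` ?top) {0..<p + q}"
    using bij[of exit_top "2 * m"]
    by (simp add: bij_betw_def inj_on_def image_image counts)
  moreover have "bij_betw strand ((\<lambda>i. (i, 2 * m - 1)) ` ?right) {p + q..<p + q + r + s}"
  proof -
    have "bij_betw (\<lambda>i. strand (i, 2 * m - 1)) ?right {p + q..<p + q + r + s}"
    proof (subst bij_betw_cong)
      show "strand (i, 2 * m - 1) = p + q + count_below exit_right i" if "i \<in> ?right" for i
        using strand_exit_right[of i] that counts by simp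
      show "bij_betw (\<lambda>i. p + q + count_below exit_right i) ?right {p + q..<p + q + r + s}"
      proof -
        have shift: "bij_betw ((+) (p + q)) {0..<r + s} {p + q..<p + q + r + s}"
          by (rule bij_betw_byWitness[where f' = "\<lambda>x. x - (p + q)"]) auto
        then show ?thesis
          using bij_betw_trans[OF bij[of exit_right "2 * n", unfolded counts] shift]
          by (simp add: comp_def)
      qed
    qed
    then show ?thesis
      by (simp add: bij_betw_def inj_on_def image_image del: strand.simps)
  qed
  ultimately have "bij_betw strand exits ({0..<p + q} \<union> {p + q..<p + q + r + s})"
    unfolding exits_def by (rule bij_betw_combine) auto
  moreover have "{0..<p + q} \<union> {p + q..<p + q + r + s} = segments (orientation_link n m \<omega>)"
    by (auto simp: link)
  ultimately show ?thesis by simp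
qed

section \<open>The link permutation as first-return map\<close>

lemma flow_interior:
  assumes "\<alpha> \<in> cells n m" "\<alpha> \<notin> exits"
  obtains i c where "\<alpha> = (Suc i, c)" "Suc i < 2 * n" "c < 2 * m"
      "letter_at (Suc i) c = U" "flow \<alpha> = (i, c)"
  | i c where "\<alpha> = (i, c)" "i < 2 * n" "Suc c < 2 * m" "letter_at i c = R" "flow \<alpha> = (i, Suc c)"
proof -
  obtain i c where \<alpha>: "\<alpha> = (i, c)" "i < 2 * n" "c < 2 * m"
    using assms by (auto simp: cells_def)
  show thesis
  proof (cases "letter_at i c")
    case U
    then have "i \<noteq> 0"
      using assms \<alpha> by (auto simp: exits_def exit_top_def)
    then show ?thesis
      using that(1)[of "i - 1" c] \<alpha> U by (simp add: flow_def step_def)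
  next
    case R
    then have "c \<noteq> 2 * m - 1"
      using assms \<alpha> by (auto simp: exits_def exit_right_def)
    then show ?thesis
      using that(2)[of i c] \<alpha> R by (simp add: flow_def step_def)
  qed
qed

lemma cyclic_on_flow_iff:
  "cyclic_on flow (cells n m) \<longleftrightarrow>
    cyclic_on (next_segment (orientation_link n m \<omega>)) (segments (orientation_link n m \<omega>))"
proof (rule cyclic_on_first_return[OF bij_betw_flow finite_cells _ _ bij_betw_strand])
  show "exits \<subseteq> cells n m"
    using n m by (auto simp: exits_def cells_def)
  \<comment> \<open>The top-right corner exits whichever letter it carries.\<close>
  have "(0, 2 * m - 1) \<in> exits"
    using n m
    by (cases "letter_at 0 (2 * m - 1)") (auto simp: exits_def exit_top_def exit_right_def)
  then show "exits \<noteq> {}" by blast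
  \<comment> \<open>The letters given by \<open>flow_interior\<close> make the increments in
    \<open>strand_Suc_row\<close> and \<open>strand_Suc_column\<close> vanish.\<close>
  show "strand (flow \<alpha>) = strand \<alpha>" if "\<alpha> \<in> cells n m" "\<alpha> \<notin> exits" for \<alpha>
    using that
    by (rule flow_interior)
      (simp_all add: strand_Suc_row strand_Suc_column del: strand.simps)
  show "strand (flow \<alpha>) = next_segment (orientation_link n m \<omega>) (strand \<alpha>)" if "\<alpha> \<in> exits" for \<alpha>
    using that strand_flow_exit_top strand_flow_exit_right
    by (auto simp: exits_def simp del: strand.simps)
  \<comment> \<open>Inside the grid the flow only goes up or right, so the distance to the top plus
    that to the right side drops.\<close>
  show "(\<lambda>(i, c). i + (2 * m - c)) (flow \<alpha>) < (\<lambda>(i, c). i + (2 * m - c)) \<alpha>"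
    if "\<alpha> \<in> cells n m" "\<alpha> \<notin> exits" for \<alpha>
    using that by (rule flow_interior) auto
qed

lemma constructs_hamiltonian_cycle_iff_cyclic_on:
  "constructs_hamiltonian_cycle n m \<omega> \<longleftrightarrow> cyclic_on flow (cells n m)"
proof -
  let ?H = "oriented_subgraph n m \<omega>"
  have "is_directed_cycle ?H \<longleftrightarrow> cyclic_on flow (verts ?H)"
    by (rule is_directed_cycle_iff_cyclic_on[where a = "\<lambda>\<alpha>. (\<alpha>, orientation n m \<omega> \<alpha>)"])
      (simp_all add: oriented_subgraph_def grid_graph_def flow_def)
  then show ?thesis
    by (simp add: constructs_hamiltonian_cycle_def oriented_subgraph_def grid_graph_def)
qed

end

theorem theorem2:
  fixes n m :: nat and \<omega> :: orientation_string
  assumes "n > 0" and "m > 0"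
  shows "constructs_hamiltonian_cycle n m \<omega> \<longleftrightarrow> is_knot (orientation_link n m \<omega>)"
proof -
  interpret oriented_grid n m \<omega>
    using assms by unfold_locales
  show ?thesis
    by (simp add: constructs_hamiltonian_cycle_iff_cyclic_on cyclic_on_flow_iff
        is_knot_iff_cyclic_on)
qed

end
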